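(* Let $\mathbf P=(P,\le,0)$ be a poset with least element $0$, let $f,g,h,F,G\in Op(P)$ and let $n$ be a positive integer. Write $f\sim g$ if $f$ and $g$ are orthogonally adjoint. Then: (i) $f\sim g$ implies $g\sim f$; (ii) $f\sim g$, $g\sim h$ and $h\sim F$ together imply $f\sim F$; (iii) $f\sim g$ and $F\sim G$ imply $f\circ F\sim G\circ g$; (iv) $f\sim g$ implies $f^n\sim g^n$; (v) $f\le g\le h$, $f\sim F$ and $h\sim F$ imply $g\sim F$; (vi) if $\mathbf P$ satisfies the Ascending Chain Condition, then $f\sim g$ is equivalent to $(\operatorname{Max} f)\sim g$; (vii) if $f\in Op(P)$ is defined by $f(x):=x^{\perp\perp}$ for all $x\in P$, then $f$ is orthogonally adjoint to itself.
   Context: Let $(P,\le,0)$ be a poset with least element $0$. For $x,y\in P$, $x\wedge y=0$ means that the infimum of $x,y$ exists and equals $0$ (i.e. $0$ is the only common lower bound of $x$ and $y$). For $A,B\subseteq P$, $A\perp B$ means $x\wedge y=0$ for all $x\in A$, $y\in B$; singletons are identified with their element. $A^\perp:=\{x\in P\mid x\perp A\}$, $A^{\perp\perp}:=(A^\perp)^\perp$, and $x^\perp:=\{x\}^\perp$. $Op(P)$ is the set of all maps $P\to 2^P$. $f,g\in Op(P)$ are orthogonally adjoint if for all $x,y\in P$: $f(x)\perp y$ if and only if $x\perp g(y)$. For $f,g\in Op(P)$, $f\le g$ means $f(x)\subseteq g(x)$ for all $x\in P$. $\operatorname{Max}A$ is the set of maximal elements of $(A,\le)$, and $(\operatorname{Max}f)(x):=\operatorname{Max}(f(x))$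 for $x\in P$. Composition of operators: $(f\circ F)(x):=f(F(x))$, where $f(A):=\bigcup_{a\in A}f(a)$ for $A\subseteq P$; $f^n$ is the $n$-fold composition of $f$ with itself. The Ascending Chain Condition means that there are no infinite (strictly) ascending chains. *)

theory Defs
  imports Main "HOL-Library.Lub_Glb"
begin

text \<open>A poset with least element is a type of class \<open>order_bot\<close>; its least element \<open>0\<close> is \<open>bot\<close>.\<close>

type_synonym 'a opr = "'a \<Rightarrow> 'a set"

definition meet_zero :: "'a::order_bot \<Rightarrow> 'a \<Rightarrow> bool" where
  "meet_zero x y \<longleftrightarrow> isGlb UNIV {x, y} bot"

definition perp :: "'a::order_bot set \<Rightarrow> 'a set \<Rightarrow> bool" where
  "perp A B \<longleftrightarrow> (\<forall>x\<in>A. \<forall>y\<in>B. meet_zero x y)"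

definition perp_set :: "'a::order_bot set \<Rightarrow> 'a set" where
  "perp_set A = {x. perp {x} A}"

definition orth_adjoint :: "'a::order_bot opr \<Rightarrow> 'a opr \<Rightarrow> bool" where
  "orth_adjoint f g \<longleftrightarrow> (\<forall>x y. perp (f x) {y} \<longleftrightarrow> perp {x} (g y))"

definition maximals :: "'a::order set \<Rightarrow> 'a set" where
  "maximals A = {m \<in> A. \<not> (\<exists>a\<in>A. m < a)}"

definition Max_opr :: "'a::order opr \<Rightarrow> 'a opr" where
  "Max_opr f = (\<lambda>x. maximals (f x))"

definition opr_comp :: "'a opr \<Rightarrow> 'a opr \<Rightarrow> 'a opr" where
  "opr_comp f F = (\<lambda>x. \<Union>a\<in>F x. f a)"

text \<open>The zeroth power is the unit of \<open>opr_comp\<close>, so that the first power is \<open>f\<close> itself.\<close>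

primrec opr_pow :: "'a opr \<Rightarrow> nat \<Rightarrow> 'a opr" where
  "opr_pow f 0 = (\<lambda>x. {x})"
| "opr_pow f (Suc n) = opr_comp f (opr_pow f n)"

lemma opr_pow_1: "opr_pow f 1 = f"
  by (simp add: opr_comp_def)

lemma meet_zero_iff: "meet_zero x y \<longleftrightarrow> (\<forall>z. z \<le> x \<and> z \<le> y \<longrightarrow> z = bot)"
  by (auto simp: meet_zero_def isGlb_def greatestP_def isLb_def setge_def setle_def bot_unique)

definition ascending_chain_condition :: "'a::order itself \<Rightarrow> bool" where
  "ascending_chain_condition _ \<longleftrightarrow> \<not> (\<exists>c :: nat \<Rightarrow> 'a. \<forall>i. c i < c (Suc i))"

end

theory Submission
  imports Defs
begin

text \<open>Orthogonality is symmetric, is tested element by element, and passes to smaller sets and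
  smaller elements. Symmetry gives (i) and (ii); elementwise testing makes operators compose like
  adjoint maps, with the order of factors reversed, which gives (iii) and, by induction, (iv);
  passing to subsets gives the squeeze (v). For (vi), \<open>perp_maximals\<close> shows that under
  ACC a set and its maximal elements are orthogonal to the same things. For (vii), A and its
  biorthogonal are orthogonal to the same elements, so both sides of the adjointness condition
  reduce to x \<perp> y.\<close>

lemma meet_zero_commute: "meet_zero x y \<longleftrightarrow> meet_zero y x"
  by (auto simp: meet_zero_iff)

lemma meet_zero_mono: "meet_zero a y \<Longrightarrow> x \<le> a \<Longrightarrow> meet_zero x y"
  by (meson meet_zero_iff order_trans)

lemma perp_commute: "perp A B \<longleftrightarrow> perp B A"
  by (meson perp_def meet_zero_commute)

lemma perp_antimono: "perp A B \<Longrightarrow> A' \<subseteq> A \<Longrightarrow> perp A' B"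
  by (auto simp: perp_def)

lemma perp_iff_left: "perp A B \<longleftrightarrow> (\<forall>a\<in>A. perp {a} B)"
  by (auto simp: perp_def)

lemma perp_iff_right: "perp A B \<longleftrightarrow> (\<forall>b\<in>B. perp A {b})"
  by (auto simp: perp_def)

lemma perp_UN_left: "perp (\<Union>i\<in>I. A i) B \<longleftrightarrow> (\<forall>i\<in>I. perp (A i) B)"
  by (auto simp: perp_def)

lemma perp_UN_right: "perp A (\<Union>i\<in>I. B i) \<longleftrightarrow> (\<forall>i\<in>I. perp A (B i))"
  by (auto simp: perp_def)

text \<open>A pointwise form of the Galois identity that a triple orthogonal equals a single
  one.\<close>

lemma perp_biorthogonal_left: "perp (perp_set (perp_set A)) {y} \<longleftrightarrow> perp A {y}"
  by (simp add: perp_def perp_set_def) (meson meet_zero_commute)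

lemma orth_adjoint_sym: "orth_adjoint f g \<Longrightarrow> orth_adjoint g f"
  by (metis orth_adjoint_def perp_commute)

text \<open>Chain of equivalences: f(x) \<perp> y, x \<perp> g(y), y \<perp> h(x), x \<perp> F(y).
  Symmetry of \<perp> swaps the roles of x and y between the links, hence three hypotheses rather
  than two.\<close>

lemma orth_adjoint_trans3:
  "orth_adjoint f g \<Longrightarrow> orth_adjoint g h \<Longrightarrow> orth_adjoint h F \<Longrightarrow> orth_adjoint f F"
  by (metis orth_adjoint_def perp_commute)

lemma orth_adjoint_comp:
  assumes "orth_adjoint f g" and "orth_adjoint F G"
  shows "orth_adjoint (opr_comp f F) (opr_comp G g)"
  unfolding orth_adjoint_def
proof (intro allI)
  fix x y
  have "perp (opr_comp f F x) {y} \<longleftrightarrow> (\<forall>a\<in>F x. perp {a} (g y))"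
    using assms(1) by (simp add: opr_comp_def perp_UN_left orth_adjoint_def)
  \<comment> \<open>Both sides say that F(x) \<perp> g(y), split once over the left set and once
    over the right.\<close>
  also have "\<dots> \<longleftrightarrow> (\<forall>b\<in>g y. perp (F x) {b})"
    by (metis perp_iff_left perp_iff_right)
  also have "\<dots> \<longleftrightarrow> perp {x} (opr_comp G g y)"
    using assms(2) by (simp add: opr_comp_def perp_UN_right orth_adjoint_def)
  finally show "perp (opr_comp f F x) {y} \<longleftrightarrow> perp {x} (opr_comp G g y)" .
qed

lemma opr_comp_assoc: "opr_comp (opr_comp f g) h = opr_comp f (opr_comp g h)"
  by (auto simp: opr_comp_def)

text \<open>Adjoints reverse composition: the inductive step for powers yields
  \<open>opr_comp (opr_pow g n) g\<close>, whereas the recursion puts the new factor on the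
  left.\<close>

lemma opr_pow_Suc_right: "opr_pow f (Suc n) = opr_comp (opr_pow f n) f"
proof (induction n)
  case 0
  show ?case by (simp add: opr_comp_def)
next
  case (Suc n)
  then show ?case by (metis opr_comp_assoc opr_pow.simps(2))
qed

lemma orth_adjoint_pow:
  assumes "orth_adjoint f g"
  shows "orth_adjoint (opr_pow f n) (opr_pow g n)"
proof (induction n)
  case 0
  show ?case by (simp add: orth_adjoint_def)
next
  case (Suc n)
  then show ?case
    using orth_adjoint_comp[OF assms Suc] by (metis opr_pow.simps(2) opr_pow_Suc_right)
qed

text \<open>The condition g(x) \<perp> y is implied by h(x) \<perp> y and implies f(x) \<perp> y,
  and these two are both equivalent to x \<perp> F(y).\<close>

lemma orth_adjoint_between:
  assumes "f \<le> g" "g \<le> h" "orth_adjoint f F" "orth_adjoint h F"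
  shows "orth_adjoint g F"
  using assms unfolding orth_adjoint_def le_fun_def by (meson perp_antimono)

lemma maximals_above:
  fixes A :: "'a::order set"
  assumes "ascending_chain_condition TYPE('a)" and "a \<in> A"
  shows "\<exists>m\<in>maximals A. a \<le> m"
proof -
  \<comment> \<open>The order is reversed, so ACC is exactly well-foundedness and the induction
    hypothesis covers all strictly larger elements.\<close>
  have "wf {(y, x). (x::'a) < y}"
    using assms(1) by (simp add: wf_iff_no_infinite_down_chain ascending_chain_condition_def)
  then show ?thesis
    using assms(2)
  proof (induction a rule: wf_induct_rule)
    case (less a)
    show ?case
    proof (cases "a \<in> maximals A")
      case False
      then obtain b where "b \<in> A" "a < b"
        using less.prems by (auto simp: maximals_def)
      then show ?thesis
        using less.IH[of b] by (auto intro: order_trans less_imp_le)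
    qed auto
  qed
qed

text \<open>Each element of A lies below a maximal one, and a zero meet is inherited by smaller
  elements.\<close>

lemma perp_maximals:
  fixes A :: "'a::order_bot set"
  assumes "ascending_chain_condition TYPE('a)"
  shows "perp (maximals A) B \<longleftrightarrow> perp A B"
proof
  assume "perp (maximals A) B"
  then show "perp A B"
    unfolding perp_def by (meson assms maximals_above meet_zero_mono)
next
  assume "perp A B"
  then show "perp (maximals A) B"
    by (rule perp_antimono) (auto simp: maximals_def)
qed

lemma orth_adjoint_Max_opr_iff:
  fixes f g :: "'a::order_bot opr"
  assumes "ascending_chain_condition TYPE('a)"
  shows "orth_adjoint (Max_opr f) g \<longleftrightarrow> orth_adjoint f g"
  by (simp add: orth_adjoint_def Max_opr_def perp_maximals[OF assms])

lemma orth_adjoint_biorthogonal: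
  "orth_adjoint (\<lambda>x. perp_set (perp_set {x})) (\<lambda>x. perp_set (perp_set {x}))"
  unfolding orth_adjoint_def by (metis perp_biorthogonal_left perp_commute)

theorem lemma4:
  fixes f g h F G :: "'a::order_bot opr" and n :: nat
  assumes "n > 0"
  shows "(orth_adjoint f g \<longrightarrow> orth_adjoint g f) \<and>
    (orth_adjoint f g \<and> orth_adjoint g h \<and> orth_adjoint h F \<longrightarrow> orth_adjoint f F) \<and>
    (orth_adjoint f g \<and> orth_adjoint F G \<longrightarrow> orth_adjoint (opr_comp f F) (opr_comp G g)) \<and>
    (orth_adjoint f g \<longrightarrow> orth_adjoint (opr_pow f n) (opr_pow g n)) \<and>
    (f \<le> g \<and> g \<le> h \<and> orth_adjoint f F \<and> orth_adjoint h F \<longrightarrow> orth_adjoint g F) \<and>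
    (ascending_chain_condition TYPE('a) \<longrightarrow>
       (orth_adjoint f g \<longleftrightarrow> orth_adjoint (Max_opr f) g)) \<and>
    (let f = (\<lambda>x::'a. perp_set (perp_set {x})) in orth_adjoint f f)"
  unfolding Let_def
  using orth_adjoint_sym[of f g] orth_adjoint_trans3[of f g h F] orth_adjoint_comp[of f g F G]
    orth_adjoint_pow[of f g n] orth_adjoint_between[of f g h F] orth_adjoint_Max_opr_iff[of f g]
    orth_adjoint_biorthogonal
  by blast

end
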